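(* For a connected graph $G$ of order $n\ge 2$ and for any real number $k\in[1,\kappa(G)]$, $k\le\dim_f^k(G)\le n$.
   Context: All graphs are finite, simple and undirected; the order of $G$ is $|V(G)|$. $d(x,y)$ is the length of a shortest path between $x$ and $y$ in $G$. For distinct $x,y\in V(G)$, let $R\{x,y\}=\{z\in V(G): d(x,z)\neq d(y,z)\}$, and let $\kappa(G)=\min\{|R\{x,y\}|: x\neq y,\ x,y\in V(G)\}$. For a function $g$ on $V(G)$ and $U\subseteq V(G)$, write $g(U)=\sum_{s\in U}g(s)$. For a real number $k\in[1,\kappa(G)]$, a function $g:V(G)\to[0,1]$ is a $k$-resolving function of $G$ if $g(R\{x,y\})\ge k$ for any two distinct vertices $x,y\in V(G)$; the fractional $k$-metric dimension is $\dim_f^k(G)=\min\{g(V(G)): g \text{ is a } k\text{-resolving function of } G\}$. *)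

theory Defs
  imports Complex_Main "HOL-Library.FuncSet" "Graph_Theory.Arc_Walk" "Graph_Theory.Digraph_Component"
begin

text \<open>
  Finite simple undirected graphs are the library's symmetric, loop-free digraphs without
  parallel arcs, i.e. the locale \<^locale>\<open>graph\<close>.
\<close>

text \<open>Meaningful when \<open>v\<close> is reachable from \<open>u\<close>; otherwise \<open>LEAST\<close> ranges over an empty set.\<close>
definition graph_dist :: "('a, 'b) pre_digraph \<Rightarrow> 'a \<Rightarrow> 'a \<Rightarrow> nat" where
  "graph_dist G u v = (LEAST l. \<exists>p. pre_digraph.apath G u p v \<and> length p = l)"

definition R_set :: "('a, 'b) pre_digraph \<Rightarrow> 'a \<Rightarrow> 'a \<Rightarrow> 'a set" where
  "R_set G x y = {z \<in> verts G. graph_dist G x z \<noteq> graph_dist G y z}"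

definition kappa :: "('a, 'b) pre_digraph \<Rightarrow> nat" where
  "kappa G = Min {card (R_set G x y) | x y. x \<in> verts G \<and> y \<in> verts G \<and> x \<noteq> y}"

definition k_resolving :: "('a, 'b) pre_digraph \<Rightarrow> real \<Rightarrow> ('a \<Rightarrow> real) \<Rightarrow> bool" where
  "k_resolving G k g \<longleftrightarrow>
     g \<in> verts G \<rightarrow> {0..1} \<and>
     (\<forall>x\<in>verts G. \<forall>y\<in>verts G. x \<noteq> y \<longrightarrow> sum g (R_set G x y) \<ge> k)"

text \<open>
  \<open>LEAST\<close> on the reals denotes a minimum, not an infimum: its value is only determined
  when the minimum is attained.
\<close>
definition frac_metric_dim :: "('a, 'b) pre_digraph \<Rightarrow> real \<Rightarrow> real" where
  "frac_metric_dim G k = (LEAST r. \<exists>g. k_resolving G k g \<and> sum g (verts G) = r)"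

end

theory Submission
  imports Defs "HOL-Analysis.Function_Topology"
begin

text \<open>
  The constant function \<open>1\<close> is \<open>k\<close>-resolving because \<open>k \<le> \<kappa>(G)\<close>, and any \<open>k\<close>-resolving
  function has total weight at least \<open>k\<close> because already a single set \<open>R{x, y}\<close> carries that much.
  The minimum defining the dimension is attained since the \<open>k\<close>-resolving functions,
  normalised to vanish off the vertices, form a compact set in the product topology.
\<close>

lemma R_set_subset: "R_set G x y \<subseteq> verts G"
  by (auto simp: R_set_def)

lemma kappa_le_card_R_set:
  assumes "finite (verts G)" "x \<in> verts G" "y \<in> verts G" "x \<noteq> y"
  shows "kappa G \<le> card (R_set G x y)"
proof -
  \<comment> \<open>\<open>Min\<close> is known to be a lower bound only for a finite set, so
    finiteness of the set of cardinalities comes first.\<close>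
  have "{card (R_set G x y) | x y. x \<in> verts G \<and> y \<in> verts G \<and> x \<noteq> y}
      \<subseteq> (\<lambda>(x, y). card (R_set G x y)) ` (verts G \<times> verts G)"
    by auto
  then have "finite {card (R_set G x y) | x y. x \<in> verts G \<and> y \<in> verts G \<and> x \<noteq> y}"
    by (rule finite_subset) (use assms(1) in simp)
  then show ?thesis
    unfolding kappa_def by (rule Min_le) (use assms in blast)
qed

text \<open>Only values on \<open>verts G\<close> enter the definition, so the others may be reset
  to 0 for the compactness argument.\<close>

lemma k_resolving_cong:
  assumes "\<And>v. v \<in> verts G \<Longrightarrow> g v = h v"
  shows "k_resolving G k g \<longleftrightarrow> k_resolving G k h"
proof -
  have "sum g (R_set G x y) = sum h (R_set G x y)" for x y
    by (rule sum.cong) (auto simp: R_set_def assms)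
  then show ?thesis
    using assms by (simp add: k_resolving_def Pi_iff)
qed

lemma k_resolving_one:
  assumes "finite (verts G)" "k \<le> real (kappa G)"
  shows "k_resolving G k (\<lambda>_. 1)"
proof -
  have "k \<le> real (card (R_set G x y))"
    if "x \<in> verts G" "y \<in> verts G" "x \<noteq> y" for x y
    using kappa_le_card_R_set[OF assms(1) that] assms(2) by linarith
  then show ?thesis
    by (simp add: k_resolving_def)
qed

lemma le_sum_k_resolving:
  assumes "finite (verts G)" "card (verts G) \<ge> 2" "k_resolving G k g"
  shows "k \<le> sum g (verts G)"
proof -
  obtain x y where "x \<in> verts G" "y \<in> verts G" "x \<noteq> y"
    using assms(1,2) card_le_Suc0_iff_eq[OF assms(1)] by fastforce
  then have "k \<le> sum g (R_set G x y)"
    using assms(3) by (simp add: k_resolving_def)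
  also have "\<dots> \<le> sum g (verts G)"
    using assms by (intro sum_mono2 R_set_subset) (auto simp: k_resolving_def Pi_iff)
  finally show ?thesis .
qed

lemma compact_k_resolving:
  "compact {g. k_resolving G k g \<and> (\<forall>v. v \<notin> verts G \<longrightarrow> g v = 0)}"
proof -
  \<comment> \<open>The factor \<open>{0}\<close> off the vertices keeps every factor compact, so
    Tychonoff's theorem applies even if \<open>'a\<close> is infinite.\<close>
  define B :: "'a \<Rightarrow> real set" where "B v = (if v \<in> verts G then {0..1} else {0})" for v
  \<comment> \<open>Sums of coordinate evaluations are continuous in the product topology, so each
    constraint is closed.\<close>
  define C where "C = (\<Inter>(x, y) \<in> {(x, y). x \<in> verts G \<and> y \<in> verts G \<and> x \<noteq> y}.
    {g :: 'a \<Rightarrow> real. k \<le> sum g (R_set G x y)})"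
  have "compactin (product_topology (\<lambda>_. euclidean) UNIV) (PiE UNIV B)"
    by (auto simp: compactin_PiE B_def)
  then have "compact (PiE UNIV B)"
    by (simp add: euclidean_product_topology)
  moreover have "closed C"
    unfolding C_def
    by (intro closed_INT ballI)
      (auto intro!: closed_Collect_le continuous_intros continuous_on_product_coordinates)
  moreover have "{g. k_resolving G k g \<and> (\<forall>v. v \<notin> verts G \<longrightarrow> g v = 0)} = PiE UNIV B \<inter> C"
    by (auto simp: k_resolving_def B_def C_def PiE_def Pi_iff split: if_splits)
  ultimately show ?thesis
    by (simp add: compact_Int_closed)
qed

text \<open>The witness \<open>h\<close> makes the compact feasible set nonempty, so a continuous
  weight attains its minimum there and \<open>LEAST\<close> denotes it.\<close>

lemma frac_metric_dim_attained:
  assumes "k_resolving G k h"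
  obtains g where "k_resolving G k g" "sum g (verts G) = frac_metric_dim G k"
    and "\<And>f. k_resolving G k f \<Longrightarrow> sum g (verts G) \<le> sum f (verts G)"
proof -
  let ?S = "{g. k_resolving G k g \<and> (\<forall>v. v \<notin> verts G \<longrightarrow> g v = 0)}"
  \<comment> \<open>Truncation by \<open>r\<close> preserves the total weight, so a minimiser among
    normalised functions is one among all.\<close>
  define r where "r f = (\<lambda>v. if v \<in> verts G then f v else 0)" for f :: "'a \<Rightarrow> real"
  have r: "r f \<in> ?S" if "k_resolving G k f" for f
    using that k_resolving_cong[of G f "r f" k] by (simp add: r_def)
  have "continuous_on ?S (\<lambda>g. sum g (verts G))"
    by (intro continuous_on_sum continuous_on_subset[OF continuous_on_product_coordinates]) auto
  then obtain g where g: "g \<in> ?S" and min: "\<forall>f\<in>?S. sum g (verts G) \<le> sum f (verts G)"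
    using continuous_attains_inf[OF compact_k_resolving] r[OF assms] by blast
  have le: "sum g (verts G) \<le> sum f (verts G)" if "k_resolving G k f" for f
    using min r[OF that] by (force simp: r_def)
  have "frac_metric_dim G k = sum g (verts G)"
    unfolding frac_metric_dim_def by (rule Least_equality) (use g le in auto)
  with g le that show thesis
    by auto
qed

theorem corollary3p4:
  fixes G :: "('a, 'b) pre_digraph" and n :: nat and k :: real
  assumes "Digraph.graph G"
    and "Digraph_Component.connected G"
    and "card (verts G) = n"
    and "n \<ge> 2"
    and "k \<in> {1..real (kappa G)}"
  shows "k \<le> frac_metric_dim G k \<and> frac_metric_dim G k \<le> real n"
proof -
  \<comment> \<open>An infinite set has \<open>card\<close> 0, contradicting
    \<open>n \<ge> 2\<close>.\<close>
  have fin: "finite (verts G)"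
    using assms(3,4) card.infinite by fastforce
  have one: "k_resolving G k (\<lambda>_. 1)"
    using k_resolving_one fin assms(5) by auto
  from frac_metric_dim_attained[OF one] obtain g
    where g: "k_resolving G k g" "sum g (verts G) = frac_metric_dim G k"
      and min: "\<And>f. k_resolving G k f \<Longrightarrow> sum g (verts G) \<le> sum f (verts G)"
    by blast
  \<comment> \<open>For the upper bound, \<open>g\<close> is compared with the constant 1, of total
    weight \<open>n\<close>.\<close>
  show ?thesis
    using le_sum_k_resolving[OF fin _ g(1)] min[OF one] g(2) assms(3,4) by simp
qed

end
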